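(* Let $c>0$, $\lambda,\widetilde\lambda>0$, $D,\widetilde D>0$, and let $F,\widetilde F$ be distribution functions of positive random variables with finite means $\mu=\int_0^\infty x\,dF(x)$ and $\widetilde\mu=\int_0^\infty x\,d\widetilde F(x)$. Assume the net profit conditions $\phi=\lambda\mu/c<1$ and $\widetilde\phi=\widetilde\lambda\widetilde\mu/c<1$, and assume $D\ge\widetilde D$ and $\mu\ge\widetilde\mu$. Let $\overline K$ and $\overline{\widetilde K}$ be the compound geometric tails associated with the classical risk processes perturbed by diffusion with parameters $(\lambda,c,F,D)$ and $(\widetilde\lambda,c,\widetilde F,\widetilde D)$, respectively. Then $$\sup_{u\ge0}\left|\overline K(u)-\overline{\widetilde K}(u)\right|\le\frac{1}{c-\lambda\mu}\left[\lambda\mu\left(\frac cD\,\mathbb K(H_1,\widetilde H_1)+\frac{|\widetilde D-D|}{D}+\frac{\mathbb K(F,\widetilde F)}{\mu}+\frac{|\widetilde\mu-\mu|}{\mu}\right)+|\lambda\mu-\widetilde\lambda\widetilde\mu|\right].$$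
   Context: The perturbed surplus process is $U(t)=u+ct-S(t)+\sigma B(t)$, $t\ge0$, where $u\ge 0$, $\sigma>0$, $D=\sigma^2/2$, $S(t)$ is a compound Poisson process with intensity $\lambda$ and claim size distribution $F$, and $B$ is an independent standard Wiener process. The relative security loading $\theta>0$ is given by $c=\lambda(1+\theta)\mu$, so $\phi=\lambda\mu/c=1/(1+\theta)$. Let $H_1(u)=1-e^{-(c/D)u}$ and $H_2(u)=F_e(u)=\frac1\mu\int_0^u\overline F(z)\,dz$ for $u\ge0$, where $\overline F=1-F$. Let $A=H_1*H_2$ (convolution of distribution functions, $A(u)=\int_0^u H_1(u-t)\,dH_2(t)$), $\overline A=1-A$, and let $A^{*n}$ denote the $n$-fold convolution of $A$ with itself, $\overline{A^{*n}}=1-A^{*n}$. The tail $\overline K$ is $$\overline K(u)=\sum_{n=1}^\infty\frac{\theta}{1+\theta}\left(\frac1{1+\theta}\right)^n\overline{A^{*n}}(u),\qquad u\ge0,$$ and it satisfies the defective renewal equation $\overline K(u)=\frac{\lambda\mu}{c}\left(\overline A(u)+\int_0^u\overline K(u-t)\,dA(t)\right)$. The objects $\widetilde H_1,\widetilde H_2,\widetilde A,\overline{\widetilde K}$ are defined in the same way from $(\widetilde\lambda,c,\widetilde F,\widetilde D)$ with the same premium rate $c$ (and $\widetilde\theta$ given by $c=\widetilde\lambda(1+\widetilde\theta)\widetilde\mu$). $\mathbb K$ denotes the Kantorovich metric: for distribution functions $F_1,F_2$ of positive random variables, $\mathbb K(F_1,F_2)=\int_0^\infty|F_1(t)-F_2(t)|\,dt$.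 *)

theory Defs
  imports "HOL-Probability.Distribution_Functions"
begin

text \<open>
  Distribution functions are functions on all of \<open>\<real>\<close>, so those prescribed only for \<open>u \<ge> 0\<close>
  are extended by \<open>0\<close> to \<open>u < 0\<close>. Integrals \<open>\<integral> \<dots> dF\<close> are taken with respect to the
  Lebesgue--Stieltjes measure \<^const>\<open>interval_measure\<close>.
\<close>

definition positive_df :: "(real \<Rightarrow> real) \<Rightarrow> bool" where
  "positive_df F \<longleftrightarrow> (\<exists>M. real_distribution M \<and> (AE x in M. 0 < x) \<and> F = cdf M)"

definition finite_mean :: "(real \<Rightarrow> real) \<Rightarrow> bool" where
  "finite_mean F \<longleftrightarrow> integrable (interval_measure F) (\<lambda>x. x)"

definition mean :: "(real \<Rightarrow> real) \<Rightarrow> real" where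
  "mean F = (LINT x|interval_measure F. x)"

definition kantorovich :: "(real \<Rightarrow> real) \<Rightarrow> (real \<Rightarrow> real) \<Rightarrow> real" where
  "kantorovich F G = (LINT t:{0..}|lborel. \<bar>F t - G t\<bar>)"

definition df_conv :: "(real \<Rightarrow> real) \<Rightarrow> (real \<Rightarrow> real) \<Rightarrow> real \<Rightarrow> real" where
  "df_conv G H u = (LINT t:{0..u}|interval_measure H. G (u - t))"

text \<open>The zeroth power is the unit mass at \<open>0\<close>, the neutral element of \<^const>\<open>df_conv\<close>.\<close>

primrec df_conv_power :: "(real \<Rightarrow> real) \<Rightarrow> nat \<Rightarrow> real \<Rightarrow> real" where
  "df_conv_power A 0 = (\<lambda>u. if u < 0 then 0 else 1)"
| "df_conv_power A (Suc n) = df_conv (df_conv_power A n) A"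

definition diffusion_df :: "real \<Rightarrow> real \<Rightarrow> real \<Rightarrow> real" where
  "diffusion_df c D u = (if u < 0 then 0 else 1 - exp (- (c / D) * u))"

definition equilibrium_df :: "(real \<Rightarrow> real) \<Rightarrow> real \<Rightarrow> real" where
  "equilibrium_df F u = (if u < 0 then 0 else 1 / mean F * (LINT z:{0..u}|lborel. 1 - F z))"

definition ladder_df :: "real \<Rightarrow> (real \<Rightarrow> real) \<Rightarrow> real \<Rightarrow> real \<Rightarrow> real" where
  "ladder_df c F D = df_conv (diffusion_df c D) (equilibrium_df F)"

text \<open>The solution \<open>\<theta>\<close> of \<open>c = lam * (1 + \<theta>) * mean F\<close>.\<close>

definition security_loading :: "real \<Rightarrow> real \<Rightarrow> (real \<Rightarrow> real) \<Rightarrow> real" where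
  "security_loading lam c F = c / (lam * mean F) - 1"

text \<open>Shifting the index by one, the sum ranges over the convolution powers \<open>n \<ge> 1\<close>.\<close>

definition compound_geometric_tail ::
    "real \<Rightarrow> real \<Rightarrow> (real \<Rightarrow> real) \<Rightarrow> real \<Rightarrow> real \<Rightarrow> real" where
  "compound_geometric_tail lam c F D u =
     (let \<theta> = security_loading lam c F in
      \<Sum>n. \<theta> / (1 + \<theta>) * (1 / (1 + \<theta>)) ^ Suc n *
          (1 - df_conv_power (ladder_df c F D) (Suc n) u))"

end

theory Submission
  imports Defs "HOL-Probability.Distributions"
begin

text \<open>
  Put \<open>p = \<lambda>\<mu>/c\<close> and \<open>q = \<lambda>'\<mu>'/c\<close>. Convolution is commutative and contracts the supremum distance
  in each argument, so \<open>\<bar>A - A'\<bar> \<le> e\<close> gives \<open>\<bar>A\<^sup>*\<^sup>n - A'\<^sup>*\<^sup>n\<bar> \<le> n e\<close>, and the geometric weights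
  \<open>(1 - p) p\<^sup>n\<close> turn this into an error \<open>p e / (1 - p)\<close>. Exchanging \<open>p\<close> for \<open>q\<close> costs at most
  \<open>\<bar>p - q\<bar> / (1 - p)\<close>: after summation by parts the weights are \<open>p\<^sup>n\<close> and \<open>q\<^sup>n\<close>, which differ by at most
  that amount, and the increments of the tails in \<open>n\<close> are nonnegative with sum at most \<open>1\<close>.

  One may take \<open>e = \<bar>D' - D\<bar> / D + \<K>(F, F') / \<mu> + \<bar>\<mu>' - \<mu>\<bar> / \<mu>\<close>: convexity of \<open>exp\<close> bounds the distance
  of the diffusion parts by \<open>\<bar>D' - D\<bar> / D\<close> alone, so of the term \<open>(c / D) \<K>(H\<^sub>1, H\<^sub>1')\<close> only its
  nonnegativity is used.
\<close>

subsection \<open>Geometric mixtures\<close>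

text \<open>Factoring out \<open>p - q\<close> leaves a sum of terms
  \<open>q ^ (n - Suc i) * p ^ i\<close>. Bounding the powers of \<open>q\<close> by 1 leaves a
  partial geometric series in \<open>p\<close> alone, so the bound is uniform in \<open>n\<close>
  and has only \<open>1 - p\<close> in the denominator.\<close>

lemma abs_power_diff_le:
  fixes p q :: real
  assumes "0 \<le> p" "p < 1" "0 \<le> q" "q < 1"
  shows "\<bar>p ^ n - q ^ n\<bar> \<le> \<bar>p - q\<bar> / (1 - p)"
proof -
  have "\<bar>p ^ n - q ^ n\<bar> = \<bar>p - q\<bar> * (\<Sum>i<n. q ^ (n - Suc i) * p ^ i)"
    using assms by (simp add: power_diff_sumr2 abs_mult sum_nonneg)
  also have "(\<Sum>i<n. q ^ (n - Suc i) * p ^ i) \<le> (\<Sum>i<n. p ^ i)"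
    using assms by (intro sum_mono mult_left_le_one_le power_le_one) auto
  also have "\<dots> \<le> (\<Sum>i. p ^ i)"
    using assms by (intro sum_le_suminf summable_geometric) auto
  also have "\<dots> = 1 / (1 - p)"
    using assms by (intro suminf_geometric) auto
  finally show ?thesis by (simp add: mult_left_mono)
qed

lemma summable_geometric_mult_bounded:
  fixes p :: real
  assumes "0 \<le> p" "p < 1" "\<And>n. \<bar>B n\<bar> \<le> 1"
  shows "summable (\<lambda>n. p ^ n * B n)"
proof (rule summable_comparison_test')
  show "summable (\<lambda>n. p ^ n)" using assms by (intro summable_geometric) auto
  show "norm (p ^ n * B n) \<le> p ^ n" for n
    using assms by (simp add: abs_mult mult_left_le)
qed

text \<open>Abel summation. It trades the weights \<open>(1 - p) * p ^ n\<close>, awkward to compare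
  for two parameters, for plain powers acting on the increments of \<open>B\<close>.\<close>

lemma suminf_geometric_weights:
  fixes p :: real
  assumes p: "0 \<le> p" "p < 1" and B: "\<And>n. \<bar>B n\<bar> \<le> 1" "B 0 = 0"
  shows "(\<Sum>n. (1 - p) * (p ^ n * B n)) = (\<Sum>n. p ^ Suc n * (B (Suc n) - B n))"
proof -
  have s: "summable (\<lambda>n. p ^ n * B n)"
    using p B by (intro summable_geometric_mult_bounded)
  then have s': "summable (\<lambda>n. p ^ Suc n * B (Suc n))"
    by (subst summable_Suc_iff)
  have "(\<Sum>n. p ^ Suc n * (B (Suc n) - B n)) = (\<Sum>n. p ^ Suc n * B (Suc n) - p * (p ^ n * B n))"
    by (simp add: algebra_simps)
  also have "\<dots> = (\<Sum>n. p ^ Suc n * B (Suc n)) - p * (\<Sum>n. p ^ n * B n)"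
    using s s' by (simp only: suminf_diff[symmetric] suminf_mult[symmetric] summable_mult)
  \<comment> \<open>The shifted series equals the full one because the term it lacks is
    \<open>B 0 = 0\<close>.\<close>
  also have "\<dots> = (1 - p) * (\<Sum>n. p ^ n * B n)"
    using suminf_split_head[OF s] B(2) by (simp add: algebra_simps)
  also have "\<dots> = (\<Sum>n. (1 - p) * (p ^ n * B n))"
    using s by (rule suminf_mult[symmetric])
  finally show ?thesis ..
qed

lemma suminf_geometric_weights_diff_le:
  fixes p q :: real
  assumes p: "0 \<le> p" "p < 1" and q: "0 \<le> q" "q < 1"
    and B: "\<And>n. 0 \<le> B n" "\<And>n. B n \<le> 1" "B 0 = 0" "\<And>n. B n \<le> B (Suc n)"
  shows "\<bar>(\<Sum>n. (1 - p) * (p ^ n * B n)) - (\<Sum>n. (1 - q) * (q ^ n * B n))\<bar> \<le> \<bar>p - q\<bar> / (1 - p)"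
proof -
  define d where "d n = B (Suc n) - B n" for n
  define K where "K = \<bar>p - q\<bar> / (1 - p)"
  have "incseq B" using B(4) by (rule incseq_SucI)
  then obtain L where L: "B \<longlonglongrightarrow> L"
    using incseq_convergent B(2) by blast
  have "L \<le> 1" using L B(2) by (intro LIMSEQ_le_const2) auto
  \<comment> \<open>The increments telescope to \<open>L - B 0\<close>, and
    \<open>B 0 = 0\<close>.\<close>
  have d: "d sums L"
    using telescope_sums[OF L] B(3) by (simp add: d_def[abs_def])
  have d0: "0 \<le> d n" for n using B(4) by (simp add: d_def)
  have d1: "\<bar>d n\<bar> \<le> 1" for n using B(1)[of n] B(2)[of "Suc n"] d0[of n] by (simp add: d_def)
  have sd: "summable (\<lambda>n. r ^ Suc n * d n)" if "0 \<le> r" "r < 1" for r :: real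
    using summable_mult[OF summable_geometric_mult_bounded[OF that d1], of r]
    by (simp add: mult.assoc)
  have "\<bar>(\<Sum>n. (1 - p) * (p ^ n * B n)) - (\<Sum>n. (1 - q) * (q ^ n * B n))\<bar>
      = \<bar>\<Sum>n. (p ^ Suc n - q ^ Suc n) * d n\<bar>"
  proof -
    have "(\<Sum>n. (1 - r) * (r ^ n * B n)) = (\<Sum>n. r ^ Suc n * d n)" if "0 \<le> r" "r < 1" for r :: real
      unfolding d_def using that B by (intro suminf_geometric_weights) auto
    then show ?thesis
      using suminf_diff[OF sd[OF p] sd[OF q]] p q by (simp only: left_diff_distrib)
  qed
  also have "\<dots> \<le> (\<Sum>n. K * d n)"
  proof -
    have le: "norm ((p ^ Suc n - q ^ Suc n) * d n) \<le> K * d n" for n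
      using mult_right_mono[OF abs_power_diff_le[OF p q, of "Suc n"] d0[of n]] d0[of n]
      unfolding K_def by (simp add: abs_mult)
    show ?thesis
      using norm_suminf_le[of "\<lambda>n. (p ^ Suc n - q ^ Suc n) * d n" "\<lambda>n. K * d n"] le d
      by (auto simp: summable_mult sums_summable)
  qed
  also have "\<dots> = K * L"
    using sums_mult[OF d, of K] by (rule sums_unique[symmetric])
  also have "\<dots> \<le> K"
    using \<open>L \<le> 1\<close> p by (intro mult_left_le) (auto simp: K_def)
  finally show ?thesis by (simp add: K_def)
qed

text \<open>The intermediate series has weights in \<open>p\<close> and terms \<open>B'\<close>.
  Passing from \<open>B\<close> to \<open>B'\<close> costs \<open>e\<close> times the mean
  \<open>p / (1 - p)\<close> of the geometric law; passing from \<open>p\<close> to \<open>q\<close>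
  is then a change of weights on the monotone sequence \<open>B'\<close>.\<close>

lemma suminf_geometric_weights_perturb_le:
  fixes p q :: real
  assumes p: "0 \<le> p" "p < 1" and q: "0 \<le> q" "q < 1"
    and B: "\<And>n. 0 \<le> B n" "\<And>n. B n \<le> 1"
    and B': "\<And>n. 0 \<le> B' n" "\<And>n. B' n \<le> 1" "B' 0 = 0" "\<And>n. B' n \<le> B' (Suc n)"
    and e: "\<And>n. \<bar>B n - B' n\<bar> \<le> real n * e"
  shows "\<bar>(\<Sum>n. (1 - p) * (p ^ n * B n)) - (\<Sum>n. (1 - q) * (q ^ n * B' n))\<bar>
    \<le> (p * e + \<bar>p - q\<bar>) / (1 - p)"
proof -
  have s: "summable (\<lambda>n. p ^ n * B n)" "summable (\<lambda>n. p ^ n * B' n)"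
    using p B B' by (auto intro!: summable_geometric_mult_bounded)
  \<comment> \<open>The differentiated geometric series, multiplied by \<open>p\<close> and shifted
    by one index, gives the sum of \<open>n * p ^ n\<close>; the term at \<open>n = 0\<close>
    vanishes.\<close>
  have "(\<lambda>n. of_nat (Suc n) * p ^ n) sums (1 / (1 - p)\<^sup>2)"
    using p by (intro geometric_deriv_sums) auto
  from sums_mult[OF this, of "p"]
  have "(\<lambda>n. real (Suc n) * p ^ Suc n) sums (p / (1 - p)\<^sup>2)"
    by (simp add: algebra_simps)
  then have "(\<lambda>n. real n * p ^ n) sums (p / (1 - p)\<^sup>2)"
    by (subst (asm) sums_Suc_iff) simp
  from sums_mult[OF this, of "(1 - p) * e"]
  have "(\<lambda>n. (1 - p) * (p ^ n * (real n * e))) sums ((1 - p) * e * (p / (1 - p)\<^sup>2))"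
    by (simp add: mult_ac)
  also have "(1 - p) * e * (p / (1 - p)\<^sup>2) = p * e / (1 - p)"
    using p by (simp add: power2_eq_square)
  finally have g: "(\<lambda>n. (1 - p) * (p ^ n * (real n * e))) sums (p * e / (1 - p))" .
  have "\<bar>(\<Sum>n. (1 - p) * (p ^ n * B n)) - (\<Sum>n. (1 - p) * (p ^ n * B' n))\<bar>
      = \<bar>\<Sum>n. (1 - p) * (p ^ n * (B n - B' n))\<bar>"
    using s by (simp add: suminf_diff summable_mult right_diff_distrib)
  also have "\<dots> \<le> (\<Sum>n. (1 - p) * (p ^ n * (real n * e)))"
  proof -
    have le: "norm ((1 - p) * (p ^ n * (B n - B' n))) \<le> (1 - p) * (p ^ n * (real n * e))" for n
      using p e[of n] by (simp add: abs_mult mult_left_mono)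
    show ?thesis
      using norm_suminf_le[OF le sums_summable[OF g]] by (simp only: real_norm_def)
  qed
  also have "\<dots> = p * e / (1 - p)"
    using g by (rule sums_unique[symmetric])
  finally show ?thesis
    using suminf_geometric_weights_diff_le[OF p q B'] by (simp add: add_divide_distrib)
qed

subsection \<open>Distribution functions on the nonnegative half-line\<close>

text \<open>Unlike \<open>positive_df\<close>, this allows an atom at 0, so the class contains the
  unit mass that starts the convolution powers.\<close>

definition nonneg_df :: "(real \<Rightarrow> real) \<Rightarrow> bool" where
  "nonneg_df F \<longleftrightarrow> (\<exists>M. real_distribution M \<and> (AE x in M. 0 \<le> x) \<and> F = cdf M)"

text \<open>A law on the reals is determined by its distribution function. Stieltjes integrals
  thereby become expectations under the original law.\<close>

lemma interval_measure_cdf: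
  assumes "real_distribution M"
  shows "interval_measure (cdf M) = M"
proof -
  interpret real_distribution M by fact
  have "real_distribution (interval_measure (cdf M))"
    by (intro real_distribution_interval_measure)
      (auto intro: cdf_nondecreasing cdf_is_right_cont cdf_lim_at_bot cdf_lim_at_top_prob)
  moreover have "cdf (interval_measure (cdf M)) = cdf M"
    by (intro cdf_interval_measure)
      (auto intro: cdf_nondecreasing cdf_is_right_cont cdf_lim_at_bot)
  ultimately show ?thesis
    using assms by (intro cdf_unique)
qed

lemma nonneg_dfI:
  assumes "real_distribution M" "AE x in M. 0 \<le> x" "\<And>x. cdf M x = F x"
  shows "nonneg_df F"
  using assms unfolding nonneg_df_def by (auto intro!: exI[of _ M])

lemma positive_df_imp_nonneg_df:
  assumes "positive_df F" shows "nonneg_df F"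
proof -
  obtain M where M: "real_distribution M" "AE x in M. 0 < x" "F = cdf M"
    using assms unfolding positive_df_def by blast
  have "AE x in M. 0 \<le> x"
    using M(2) by eventually_elim simp
  then show ?thesis
    using M by (auto intro: nonneg_dfI)
qed

lemma positive_df_AE:
  assumes "positive_df F" shows "AE x in interval_measure F. 0 < x"
proof -
  obtain M where M: "real_distribution M" "AE x in M. 0 < x" "F = cdf M"
    using assms unfolding positive_df_def by blast
  show ?thesis
    unfolding M(3) interval_measure_cdf[OF M(1)] by (rule M(2))
qed

context
  fixes F :: "real \<Rightarrow> real"
  assumes F: "nonneg_df F"
begin

lemma nonneg_df_real_distribution: "real_distribution (interval_measure F)"
  using F unfolding nonneg_df_def by (auto simp: interval_measure_cdf)

lemma nonneg_df_AE: "AE x in interval_measure F. 0 \<le> x"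
proof -
  obtain M where M: "real_distribution M" "AE x in M. 0 \<le> x" "F = cdf M"
    using F unfolding nonneg_df_def by blast
  show ?thesis
    unfolding M(3) interval_measure_cdf[OF M(1)] by (rule M(2))
qed

lemma nonneg_df_cdf: "cdf (interval_measure F) = F"
  using F unfolding nonneg_df_def by (auto simp: interval_measure_cdf)

lemma nonneg_df_nonneg: "0 \<le> F x"
  by (metis nonneg_df_cdf nonneg_df_real_distribution real_distribution.finite_borel_measure_M
      finite_borel_measure.cdf_nonneg)

lemma nonneg_df_le_one: "F x \<le> 1"
  by (metis nonneg_df_cdf nonneg_df_real_distribution real_distribution.cdf_bounded_prob)

lemma nonneg_df_mono: "x \<le> y \<Longrightarrow> F x \<le> F y"
  by (metis nonneg_df_cdf nonneg_df_real_distribution real_distribution.finite_borel_measure_M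
      finite_borel_measure.cdf_nondecreasing)

lemma nonneg_df_measurable: "F \<in> borel_measurable borel"
  by (intro borel_measurable_mono monoI nonneg_df_mono)

lemma nonneg_df_neg:
  assumes "x < 0" shows "F x = 0"
proof -
  interpret real_distribution "interval_measure F" by (rule nonneg_df_real_distribution)
  have "measure (interval_measure F) {..x} = measure (interval_measure F) {}"
    using nonneg_df_AE assms by (intro measure_eq_AE) auto
  then show ?thesis
    using nonneg_df_cdf by (metis cdf_def2 measure_empty)
qed

end

section \<open>Convolution of two distribution functions\<close>

lemma nonneg_df_integrable:
  assumes "nonneg_df G" "nonneg_df H"
  shows "integrable (interval_measure H) (\<lambda>t. G (u - t))"
proof -
  interpret real_distribution "interval_measure H"
    by (rule nonneg_df_real_distribution) fact
  note [measurable] = nonneg_df_measurable[OF assms(1)]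
  show ?thesis
    by (intro integrable_const_bound[of _ 1])
      (auto intro!: AE_I2 simp: nonneg_df_nonneg[OF assms(1)] nonneg_df_le_one[OF assms(1)])
qed

text \<open>The restriction to \<open>{0..u}\<close> costs nothing: negative \<open>t\<close> form a
  null set, and \<open>G (u - t)\<close> vanishes for \<open>t > u\<close>.\<close>

lemma df_conv_eq_integral:
  assumes "nonneg_df G" "nonneg_df H"
  shows "df_conv G H u = (LINT t|interval_measure H. G (u - t))"
proof -
  note [measurable] = nonneg_df_measurable[OF assms(1)]
  show ?thesis
    unfolding df_conv_def set_lebesgue_integral_def
  proof (rule integral_cong_AE)
    show "AE t in interval_measure H. indicator {0..u} t *\<^sub>R G (u - t) = G (u - t)"
      using nonneg_df_AE[OF assms(2)]
      by eventually_elim (auto simp: indicator_def nonneg_df_neg[OF assms(1)])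
  qed simp_all
qed

text \<open>For independent X and Y with laws H and G, conditioning on X gives P(X + Y <= u) = E G(u
  - X). Commutativity and closure of \<open>df_conv\<close> are then inherited from convolution of
  measures.\<close>

lemma df_conv_eq_cdf:
  assumes "nonneg_df G" "nonneg_df H"
  shows "df_conv G H u = cdf (interval_measure H \<star> interval_measure G) u"
proof -
  interpret G: real_distribution "interval_measure G"
    by (rule nonneg_df_real_distribution) fact
  interpret H: real_distribution "interval_measure H"
    by (rule nonneg_df_real_distribution) fact
  have "emeasure (interval_measure H \<star> interval_measure G) {..u}
      = (\<integral>\<^sup>+x. emeasure (interval_measure G) {a. a + x \<in> {..u}} \<partial>interval_measure H)"
    by (intro convolution_emeasure) (auto intro: G.finite_measure_axioms H.finite_measure_axioms)
  also have "\<dots> = (\<integral>\<^sup>+x. ennreal (G (u - x)) \<partial>interval_measure H)"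
  proof (intro nn_integral_cong)
    fix x
    have "{a. a + x \<in> {..u}} = {..u - x}" by auto
    then show "emeasure (interval_measure G) {a. a + x \<in> {..u}} = ennreal (G (u - x))"
      using nonneg_df_cdf[OF assms(1)] by (metis G.emeasure_eq_measure cdf_def2)
  qed
  also have "\<dots> = ennreal (LINT t|interval_measure H. G (u - t))"
    by (intro nn_integral_eq_integral nonneg_df_integrable assms)
      (simp add: nonneg_df_nonneg[OF assms(1)])
  finally show ?thesis
    unfolding cdf_def2 df_conv_eq_integral[OF assms]
    by (simp add: measure_def nonneg_df_nonneg[OF assms(1)])
qed

lemma df_conv_commute:
  assumes "nonneg_df G" "nonneg_df H"
  shows "df_conv G H = df_conv H G"
proof -
  interpret G: real_distribution "interval_measure G"
    by (rule nonneg_df_real_distribution) fact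
  interpret H: real_distribution "interval_measure H"
    by (rule nonneg_df_real_distribution) fact
  have "(interval_measure G \<star> interval_measure H) = (interval_measure H \<star> interval_measure G)"
    by (intro convolution_commutative) (auto intro: G.finite_measure_axioms H.finite_measure_axioms)
  then show ?thesis
    by (simp add: fun_eq_iff df_conv_eq_cdf assms)
qed

lemma nonneg_df_df_conv:
  assumes "nonneg_df G" "nonneg_df H"
  shows "nonneg_df (df_conv G H)"
proof (rule nonneg_dfI)
  interpret G: real_distribution "interval_measure G"
    by (rule nonneg_df_real_distribution) fact
  interpret H: real_distribution "interval_measure H"
    by (rule nonneg_df_real_distribution) fact
  interpret HG: pair_prob_space "interval_measure H" "interval_measure G" ..
  have [measurable]: "(\<lambda>(x, y). x + y) \<in> interval_measure H \<Otimes>\<^sub>M interval_measure G \<rightarrow>\<^sub>M (borel :: real measure)"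
    by measurable
  show "real_distribution (interval_measure H \<star> interval_measure G)"
    unfolding convolution_def by (intro HG.real_distribution_distr) simp
  have "AE p in interval_measure H \<Otimes>\<^sub>M interval_measure G. 0 \<le> fst p + snd p"
  proof -
    have "AE x in interval_measure H. AE y in interval_measure G. 0 \<le> x + y"
      using nonneg_df_AE[OF assms(2)]
    proof eventually_elim
      case (elim x)
      then show ?case using nonneg_df_AE[OF assms(1)] by (auto elim: eventually_mono)
    qed
    then show ?thesis by (intro HG.AE_pair_measure) measurable
  qed
  then show "AE x in interval_measure H \<star> interval_measure G. 0 \<le> x"
    unfolding convolution_def by (subst AE_distr_iff) (auto simp: case_prod_beta)
qed (simp add: df_conv_eq_cdf assms)

text \<open>The difference is an average of \<open>G - G'\<close> against a probability
  measure.\<close>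

lemma df_conv_diff_le:
  assumes "nonneg_df G" "nonneg_df G'" "nonneg_df H"
    and "\<And>x. \<bar>G x - G' x\<bar> \<le> a"
  shows "\<bar>df_conv G H u - df_conv G' H u\<bar> \<le> a"
proof -
  interpret H: real_distribution "interval_measure H"
    by (rule nonneg_df_real_distribution) fact
  have [intro]: "integrable (interval_measure H) (\<lambda>t. G (u - t))"
    "integrable (interval_measure H) (\<lambda>t. G' (u - t))"
    using assms by (auto intro: nonneg_df_integrable)
  have "\<bar>df_conv G H u - df_conv G' H u\<bar> = \<bar>LINT t|interval_measure H. G (u - t) - G' (u - t)\<bar>"
    using assms by (subst Bochner_Integration.integral_diff) (auto simp: df_conv_eq_integral)
  also have "\<dots> \<le> (LINT t|interval_measure H. \<bar>G (u - t) - G' (u - t)\<bar>)"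
    by (rule integral_abs_bound)
  also have "\<dots> \<le> (LINT t|interval_measure H. a)"
    using assms(4) by (intro integral_mono integrable_abs Bochner_Integration.integrable_diff) auto
  finally show ?thesis using H.prob_space by simp
qed

text \<open>One argument is changed at a time, through \<open>df_conv G' H\<close>; commutativity
  moves the second change into the first slot.\<close>

lemma df_conv_diff_le_add:
  assumes df: "nonneg_df G" "nonneg_df G'" "nonneg_df H" "nonneg_df H'"
    and le: "\<And>x. \<bar>G x - G' x\<bar> \<le> a" "\<And>x. \<bar>H x - H' x\<bar> \<le> b"
  shows "\<bar>df_conv G H u - df_conv G' H' u\<bar> \<le> a + b"
proof -
  have "\<bar>df_conv G H u - df_conv G' H u\<bar> \<le> a"
    using df le by (intro df_conv_diff_le)
  moreover have "\<bar>df_conv G' H u - df_conv G' H' u\<bar> \<le> b"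
    unfolding df_conv_commute[OF df(2,3)] df_conv_commute[OF df(2,4)]
    using df le by (intro df_conv_diff_le)
  ultimately show ?thesis by linarith
qed

text \<open>Adding a nonnegative summand can only lower the distribution function.\<close>

lemma df_conv_le:
  assumes "nonneg_df G" "nonneg_df H"
  shows "df_conv G H u \<le> G u"
proof -
  interpret H: real_distribution "interval_measure H"
    by (rule nonneg_df_real_distribution) fact
  have "df_conv G H u \<le> (LINT t|interval_measure H. G u)"
    unfolding df_conv_eq_integral[OF assms]
  proof (rule integral_mono_AE)
    show "integrable (interval_measure H) (\<lambda>t. G (u - t))"
      using assms by (rule nonneg_df_integrable)
    show "AE t in interval_measure H. G (u - t) \<le> G u"
      using nonneg_df_AE[OF assms(2)]
      by eventually_elim (auto intro!: nonneg_df_mono[OF assms(1)])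
  qed simp
  then show ?thesis using H.prob_space by simp
qed

section \<open>Convolution powers\<close>

lemma nonneg_df_df_conv_power:
  assumes "nonneg_df A"
  shows "nonneg_df (df_conv_power A n)"
proof (induction n)
  case 0
  have "real_distribution (return borel 0)"
    by (auto simp: real_distribution_def real_distribution_axioms_def prob_space_return)
  moreover have "AE x in return borel 0. 0 \<le> (x :: real)"
    by (subst AE_return) simp_all
  ultimately show ?case
    by (rule nonneg_dfI) (auto simp: cdf_def2 measure_def)
next
  case (Suc n)
  then show ?case using assms by (simp add: nonneg_df_df_conv)
qed

text \<open>Hence the tails of the powers increase with \<open>n\<close>, as the change of geometric
  parameter requires.\<close>

lemma df_conv_power_Suc_le:
  assumes "nonneg_df A"
  shows "df_conv_power A (Suc n) u \<le> df_conv_power A n u"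
  by (simp add: df_conv_le nonneg_df_df_conv_power assms)

text \<open>Each convolution factor contributes one further \<open>e\<close>.\<close>

lemma df_conv_power_diff_le:
  assumes "nonneg_df A" "nonneg_df A'" "\<And>x. \<bar>A x - A' x\<bar> \<le> e"
  shows "\<bar>df_conv_power A n u - df_conv_power A' n u\<bar> \<le> real n * e"
proof (induction n arbitrary: u)
  case (Suc n)
  have "\<bar>df_conv_power A (Suc n) u - df_conv_power A' (Suc n) u\<bar> \<le> real n * e + e"
    unfolding df_conv_power.simps using assms Suc.IH
    by (intro df_conv_diff_le_add nonneg_df_df_conv_power)
  then show ?case by (simp add: algebra_simps)
qed simp

subsection \<open>Diffusion and equilibrium distributions\<close>

lemma nonneg_df_diffusion_df:
  assumes "c > 0" "D > 0"
  shows "nonneg_df (diffusion_df c D)"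
proof (rule nonneg_dfI)
  let ?M = "density lborel (exponential_density (c / D))"
  have l: "0 < c / D" using assms by simp
  then show "real_distribution ?M"
    by (auto simp: real_distribution_def real_distribution_axioms_def prob_space_exponential_density)
  show "AE x in ?M. 0 \<le> x"
    by (subst AE_density) (auto simp: exponential_density_def)
  show "cdf ?M x = diffusion_df c D x" for x
    \<comment> \<open>The exponential density is the Erlang density of index 0.\<close>
    using emeasure_erlang_density[OF l, of 0 x] erlang_CDF_nonneg[OF l, of 0 x]
    by (simp add: cdf_def2 measure_def erlang_CDF_0 diffusion_df_def)
qed

text \<open>With \<open>s = D' / D\<close> the two exponents are \<open>- (s * y)\<close> and
  \<open>- y\<close>. Since \<open>D' \<le> D\<close> gives \<open>s \<le> 1\<close>, the first is a
  convex combination of \<open>- y\<close> and 0, so the exponentials differ by at most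
  \<open>1 - s\<close>, uniformly in \<open>c\<close> and \<open>u\<close>.\<close>

lemma diffusion_df_diff_le:
  assumes "c > 0" "D' > 0" "D' \<le> D"
  shows "\<bar>diffusion_df c D u - diffusion_df c D' u\<bar> \<le> \<bar>D' - D\<bar> / D"
proof (cases "u < 0")
  case False
  define s where "s = D' / D"
  define y where "y = c / D' * u"
  have s: "0 \<le> s" "s \<le> 1" and D: "D > 0" and y: "0 \<le> y"
    using assms False by (auto simp: s_def y_def)
  have sy: "c / D * u = s * y"
    using assms D by (simp add: s_def y_def)
  have "exp (- (s * y)) \<le> s * exp (- y) + (1 - s)"
    using convex_onD[OF exp_convex, of s 0 "- y"] s by simp
  moreover have "s * exp (- y) \<le> exp (- y)"
    using s by (simp add: mult_le_cancel_right1)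
  moreover have "exp (- y) \<le> exp (- (s * y))"
    using s y by (simp add: mult_left_le_one_le)
  moreover have "\<bar>D' - D\<bar> / D = 1 - s"
    using assms D by (simp add: s_def field_simps)
  moreover have "diffusion_df c D u - diffusion_df c D' u = exp (- y) - exp (- (s * y))"
    using False unfolding diffusion_df_def minus_mult_left[symmetric] sy y_def[symmetric] by simp
  ultimately show ?thesis by linarith
qed (use assms in \<open>simp add: diffusion_df_def\<close>)

section \<open>Means, integrated tails and equilibrium distributions\<close>

lemma mean_pos:
  assumes "positive_df F" "finite_mean F"
  shows "0 < mean F"
proof -
  interpret real_distribution "interval_measure F"
    using assms by (intro nonneg_df_real_distribution positive_df_imp_nonneg_df)
  have pos: "AE x in interval_measure F. 0 < x"
    using assms(1) by (rule positive_df_AE)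
  then have nonneg: "AE x in interval_measure F. 0 \<le> x"
    by eventually_elim simp
  \<comment> \<open>A nonnegative variable of mean zero vanishes almost surely, which contradicts
    strict positivity.\<close>
  have "mean F \<noteq> 0"
  proof
    assume "mean F = 0"
    then have "AE x in interval_measure F. x = 0"
      using integral_nonneg_eq_0_iff_AE[OF _ nonneg] assms(2)
      by (simp add: mean_def finite_mean_def)
    with pos have "AE x in interval_measure F. False"
      by eventually_elim simp
    then show False by simp
  qed
  moreover have "0 \<le> mean F"
    unfolding mean_def using nonneg by (rule integral_nonneg_AE)
  ultimately show ?thesis by simp
qed

text \<open>Write \<open>1 - F z\<close> as the probability of exceeding \<open>z\<close> and apply
  Tonelli: the inner integral becomes the length of \<open>{0..<x}\<close>, that is
  \<open>x\<close>.\<close>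

lemma nn_integral_tail:
  assumes "nonneg_df F" "finite_mean F"
  shows "(\<integral>\<^sup>+z. ennreal (indicator {0..} z * (1 - F z)) \<partial>lborel) = ennreal (mean F)"
proof -
  let ?M = "interval_measure F"
  interpret real_distribution ?M
    using assms(1) by (rule nonneg_df_real_distribution)
  interpret pair_sigma_finite lborel ?M ..
  have tail: "ennreal (indicator {0..} z * (1 - F z))
      = (\<integral>\<^sup>+x. indicator {0..} z * indicator {z<..} x \<partial>?M)" for z
  proof -
    have "measure ?M {z<..} = measure ?M (space ?M - {..z})"
      by (rule arg_cong[of _ _ "measure ?M"]) auto
    also have "\<dots> = 1 - cdf ?M z"
      by (subst prob_compl) (simp_all add: cdf_def2)
    finally have "emeasure ?M {z<..} = ennreal (1 - F z)"
      by (simp add: emeasure_eq_measure nonneg_df_cdf[OF assms(1)])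
    then show ?thesis
      by (subst nn_integral_cmult) (auto simp: indicator_def[of "{0..}"])
  qed
  have "(\<integral>\<^sup>+z. ennreal (indicator {0..} z * (1 - F z)) \<partial>lborel)
      = (\<integral>\<^sup>+z. \<integral>\<^sup>+x. (if 0 \<le> z \<and> z < x then 1 else 0) \<partial>?M \<partial>lborel)"
    unfolding tail by (intro nn_integral_cong) (auto simp: indicator_def)
  also have "\<dots> = (\<integral>\<^sup>+x. \<integral>\<^sup>+z. (if 0 \<le> z \<and> z < x then 1 else 0) \<partial>lborel \<partial>?M)"
    by (rule Fubini'[symmetric]) measurable
  also have "\<dots> = (\<integral>\<^sup>+x. ennreal x \<partial>?M)"
  proof (rule nn_integral_cong_AE)
    show "AE x in ?M. (\<integral>\<^sup>+z. (if 0 \<le> z \<and> z < x then 1 else 0) \<partial>lborel) = ennreal x"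
      using nonneg_df_AE[OF assms(1)]
    proof eventually_elim
      case (elim x)
      have "(\<integral>\<^sup>+z. (if 0 \<le> z \<and> z < x then 1 else 0) \<partial>lborel)
          = (\<integral>\<^sup>+z. indicator {0..<x} z \<partial>lborel)"
        by (intro nn_integral_cong) (auto simp: indicator_def)
      then show ?case using elim by simp
    qed
  qed
  also have "\<dots> = ennreal (mean F)"
    unfolding mean_def using assms(2) nonneg_df_AE[OF assms(1)]
    by (intro nn_integral_eq_integral) (auto simp: finite_mean_def)
  finally show ?thesis .
qed

lemma
  assumes "nonneg_df F" "finite_mean F"
  shows set_integrable_tail: "set_integrable lborel {0..} (\<lambda>z. 1 - F z)"
    and set_integral_tail: "(LINT z:{0..}|lborel. 1 - F z) = mean F"
proof -
  note [measurable] = nonneg_df_measurable[OF assms(1)]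
  have m: "0 \<le> mean F"
    unfolding mean_def using nonneg_df_AE[OF assms(1)] by (rule integral_nonneg_AE)
  have "has_bochner_integral lborel (\<lambda>z. indicator {0..} z * (1 - F z)) (mean F)"
    using nn_integral_tail[OF assms] m nonneg_df_le_one[OF assms(1)]
    by (intro has_bochner_integral_nn_integral) auto
  then show "set_integrable lborel {0..} (\<lambda>z. 1 - F z)" "(LINT z:{0..}|lborel. 1 - F z) = mean F"
    by (auto simp: set_integrable_def set_lebesgue_integral_def has_bochner_integral_iff)
qed

text \<open>The law has density \<open>(1 - F z) / mean F\<close> on the half-line; its total mass
  is 1 by \<open>nn_integral_tail\<close>.\<close>

lemma nonneg_df_equilibrium_df:
  assumes "nonneg_df F" "finite_mean F" "0 < mean F"
  shows "nonneg_df (equilibrium_df F)"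
proof (rule nonneg_dfI)
  note [measurable] = nonneg_df_measurable[OF assms(1)]
  note [simp] = nonneg_df_le_one[OF assms(1)]
  let ?f = "\<lambda>z. ennreal (indicator {0..} z * (1 - F z) / mean F)"
  let ?M = "density lborel ?f"
  have f: "?f = (\<lambda>z. ennreal (1 / mean F) * ennreal (indicator {0..} z * (1 - F z)))"
    using assms(3) by (simp add: fun_eq_iff flip: ennreal_mult)
  have "emeasure ?M (space ?M) = ennreal (1 / mean F) * ennreal (mean F)"
    using nn_integral_tail[OF assms(1,2)] unfolding f
    by (simp add: emeasure_density nn_integral_cmult)
  then have "prob_space ?M"
    using assms(3) by (intro prob_spaceI) (simp flip: ennreal_mult)
  then show "real_distribution ?M"
    by (simp add: real_distribution_def real_distribution_axioms_def)
  show "AE x in ?M. 0 \<le> x"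
    by (subst AE_density) (auto simp: indicator_def)
  show "cdf ?M u = equilibrium_df F u" for u
  proof -
    have int: "set_integrable lborel {0..u} (\<lambda>z. 1 - F z)"
      by (rule set_integrable_subset[OF set_integrable_tail[OF assms(1,2)]]) auto
    have "emeasure ?M {..u}
        = (\<integral>\<^sup>+z. ennreal (1 / mean F) * ennreal (indicator {0..u} z * (1 - F z)) \<partial>lborel)"
      unfolding f by (subst emeasure_density) (auto intro!: nn_integral_cong simp: indicator_def)
    also have "\<dots> = ennreal (1 / mean F) * (\<integral>\<^sup>+z. ennreal (indicator {0..u} z * (1 - F z)) \<partial>lborel)"
      by (rule nn_integral_cmult) simp
    also have "(\<integral>\<^sup>+z. ennreal (indicator {0..u} z * (1 - F z)) \<partial>lborel)
        = ennreal (LINT z:{0..u}|lborel. 1 - F z)"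
      using int nn_integral_eq_integral[of lborel "\<lambda>z. indicator {0..u} z * (1 - F z)"]
      by (simp add: set_integrable_def set_lebesgue_integral_def)
    finally have "emeasure ?M {..u} = ennreal (1 / mean F * (LINT z:{0..u}|lborel. 1 - F z))"
      using assms(3) by (simp flip: ennreal_mult add: set_lebesgue_integral_def)
    then have "cdf ?M u = 1 / mean F * (LINT z:{0..u}|lborel. 1 - F z)"
      using assms(3) by (simp add: cdf_def2 measure_def set_lebesgue_integral_def)
    \<comment> \<open>For \<open>u < 0\<close> the interval \<open>{0..u}\<close> is empty, so the
      formula also gives the prescribed value 0.\<close>
    then show ?thesis
      by (simp add: equilibrium_df_def set_lebesgue_integral_def)
  qed
qed

lemma kantorovich_nonneg: "0 \<le> kantorovich F G"
  unfolding kantorovich_def set_lebesgue_integral_def by (intro Bochner_Integration.integral_nonneg) auto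

lemma equilibrium_df_diff_le:
  assumes F: "nonneg_df F" "finite_mean F" "0 < mean F"
    and F': "nonneg_df F'" "finite_mean F'" "0 < mean F'"
  shows "\<bar>equilibrium_df F u - equilibrium_df F' u\<bar>
    \<le> kantorovich F F' / mean F + \<bar>mean F' - mean F\<bar> / mean F"
proof (cases "u < 0")
  case True
  then show ?thesis
    using F(3) kantorovich_nonneg[of F F'] by (simp add: equilibrium_df_def)
next
  case False
  define I where "I = (LINT z:{0..u}|lborel. 1 - F z)"
  define I' where "I' = (LINT z:{0..u}|lborel. 1 - F' z)"
  let ?m = "mean F" and ?m' = "mean F'"
  note tails = set_integrable_tail[OF F(1,2)] set_integrable_tail[OF F'(1,2)]
  \<comment> \<open>Integrability matters here: otherwise the integral in \<open>kantorovich\<close>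
    would take the default value 0 and dominate nothing.\<close>
  have diff: "set_integrable lborel {0..} (\<lambda>z. \<bar>F z - F' z\<bar>)"
    using set_integrable_abs[OF set_integral_diff(1)[OF tails(2,1)]] by simp
  have sub: "set_integrable lborel {0..u} f" if "set_integrable lborel {0..} f" for f :: "real \<Rightarrow> real"
    by (rule set_integrable_subset[OF that]) auto
  have "\<bar>I - I'\<bar> = \<bar>LINT z:{0..u}|lborel. (1 - F z) - (1 - F' z)\<bar>"
    unfolding I_def I'_def by (subst set_integral_diff) (auto intro: sub tails)
  also have "\<dots> \<le> (LINT z:{0..u}|lborel. \<bar>(1 - F z) - (1 - F' z)\<bar>)"
    unfolding set_lebesgue_integral_def
    by (rule order_trans[OF integral_abs_bound]) (simp add: abs_mult)
  also have "\<dots> = (LINT z:{0..u}|lborel. \<bar>F z - F' z\<bar>)"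
    by (simp add: abs_minus_commute)
  also have "\<dots> \<le> kantorovich F F'"
    unfolding kantorovich_def set_lebesgue_integral_def
    using diff sub[OF diff] by (intro integral_mono) (auto simp: set_integrable_def indicator_def)
  finally have II': "\<bar>I - I'\<bar> \<le> kantorovich F F'" .
  have I'0: "0 \<le> I'"
    using nonneg_df_le_one[OF F'(1)]
    by (auto simp: I'_def set_lebesgue_integral_def intro!: Bochner_Integration.integral_nonneg)
  have I'm: "I' \<le> ?m'"
    unfolding I'_def set_integral_tail[OF F'(1,2), symmetric] set_lebesgue_integral_def
    using tails(2) sub[OF tails(2)] nonneg_df_le_one[OF F'(1)]
    by (intro integral_mono) (auto simp: set_integrable_def indicator_def)
  \<comment> \<open>Inserting \<open>I' / ?m\<close> separates the change of tail from the change of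
    normalisation; the factor \<open>I' / ?m'\<close> lies between 0 and 1, which leaves only
    \<open>?m\<close> in the denominators.\<close>
  have "equilibrium_df F u - equilibrium_df F' u = (I - I') / ?m + I' / ?m' * ((?m' - ?m) / ?m)"
    using False F(3) F'(3) by (simp add: equilibrium_df_def I_def I'_def field_simps)
  also have "\<bar>\<dots>\<bar> \<le> \<bar>I - I'\<bar> / ?m + I' / ?m' * (\<bar>?m' - ?m\<bar> / ?m)"
    using abs_triangle_ineq[of "(I - I') / ?m" "I' / ?m' * ((?m' - ?m) / ?m)"] F(3) F'(3) I'0
    by (simp add: abs_mult)
  also have "\<dots> \<le> kantorovich F F' / ?m + 1 * (\<bar>?m' - ?m\<bar> / ?m)"
    using II' I'm F(3) F'(3) by (intro add_mono divide_right_mono mult_right_mono) auto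
  finally show ?thesis by simp
qed

subsection \<open>Compound geometric tails\<close>

text \<open>Here \<open>1 / (1 + \<theta>) = p\<close> and
  \<open>\<theta> / (1 + \<theta>) = 1 - p\<close>. The sum may start at \<open>n = 0\<close>
  because the zeroth power equals 1 at every \<open>u \<ge> 0\<close>, so its tail is 0.\<close>

lemma compound_geometric_tail_eq:
  assumes "nonneg_df (ladder_df c F D)" "lam * mean F / c = p" "0 < p" "p < 1" "0 \<le> u"
  shows "compound_geometric_tail lam c F D u
    = (\<Sum>n. (1 - p) * (p ^ n * (1 - df_conv_power (ladder_df c F D) n u)))"
proof -
  let ?A = "df_conv_power (ladder_df c F D)"
  have th: "security_loading lam c F = 1 / p - 1"
    using assms(2) by (auto simp: security_loading_def)
  have "\<bar>1 - ?A n u\<bar> \<le> 1" for n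
    using nonneg_df_nonneg nonneg_df_le_one nonneg_df_df_conv_power[OF assms(1)]
    by (simp add: abs_le_iff)
  then have "summable (\<lambda>n. (1 - p) * (p ^ n * (1 - ?A n u)))"
    using assms by (intro summable_mult summable_geometric_mult_bounded) auto
  moreover have "1 / (1 + (1 / p - 1)) = p" "(1 / p - 1) / (1 + (1 / p - 1)) = 1 - p"
    using assms(3) by (simp_all add: field_simps)
  ultimately show ?thesis
    using suminf_split_head[of "\<lambda>n. (1 - p) * (p ^ n * (1 - ?A n u))"] assms(5)
    unfolding compound_geometric_tail_def Let_def th
    by (simp add: mult.assoc del: df_conv_power.simps(2))
qed

theorem theorem3:
  fixes c lam lam' D D' \<mu> \<mu>' :: real and F F' :: "real \<Rightarrow> real"
  assumes "c > 0" and "lam > 0" and "lam' > 0" and "D > 0" and "D' > 0"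
    and "positive_df F" and "positive_df F'"
    and "finite_mean F" and "finite_mean F'"
    and "\<mu> = mean F" and "\<mu>' = mean F'"
    and "lam * \<mu> / c < 1" and "lam' * \<mu>' / c < 1"
    and "D \<ge> D'" and "\<mu> \<ge> \<mu>'"
  shows "(SUP u\<in>{0..}. ereal \<bar>compound_geometric_tail lam c F D u
                            - compound_geometric_tail lam' c F' D' u\<bar>)
    \<le> ereal (1 / (c - lam * \<mu>) *
        (lam * \<mu> * (c / D * kantorovich (diffusion_df c D) (diffusion_df c D')
                   + \<bar>D' - D\<bar> / D + kantorovich F F' / \<mu> + \<bar>\<mu>' - \<mu>\<bar> / \<mu>)
         + \<bar>lam * \<mu> - lam' * \<mu>'\<bar>))"
proof (rule SUP_least)
  \<comment> \<open>The supremum lives in the extended reals, so a uniform pointwise bound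
    suffices.\<close>
  fix u :: real assume "u \<in> {0..}"
  then have u: "0 \<le> u" by simp
  define p where "p = lam * \<mu> / c"
  define q where "q = lam' * \<mu>' / c"
  define A where "A = ladder_df c F D"
  define A' where "A' = ladder_df c F' D'"
  define e where "e = \<bar>D' - D\<bar> / D + kantorovich F F' / \<mu> + \<bar>\<mu>' - \<mu>\<bar> / \<mu>"
  have \<mu>: "0 < \<mu>" "0 < \<mu>'"
    using assms by (auto intro: mean_pos)
  have p: "0 < p" "p < 1" and q: "0 < q" "q < 1"
    using assms \<mu> by (auto simp: p_def q_def)
  have df: "nonneg_df F" "nonneg_df F'"
    using assms by (auto intro: positive_df_imp_nonneg_df)
  have H: "nonneg_df (diffusion_df c D)" "nonneg_df (diffusion_df c D')"
    "nonneg_df (equilibrium_df F)" "nonneg_df (equilibrium_df F')"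
    using assms df \<mu> by (auto intro: nonneg_df_diffusion_df nonneg_df_equilibrium_df)
  have A: "nonneg_df A" "nonneg_df A'"
    unfolding A_def A'_def ladder_df_def using H by (auto intro: nonneg_df_df_conv)
  have AA': "\<bar>A x - A' x\<bar> \<le> e" for x
  proof -
    have "\<bar>A x - A' x\<bar> \<le> \<bar>D' - D\<bar> / D + (kantorovich F F' / \<mu> + \<bar>\<mu>' - \<mu>\<bar> / \<mu>)"
      unfolding A_def A'_def ladder_df_def \<open>\<mu> = mean F\<close> \<open>\<mu>' = mean F'\<close>
      using assms df \<mu>
      by (intro df_conv_diff_le_add H diffusion_df_diff_le equilibrium_df_diff_le) auto
    then show ?thesis by (simp add: e_def)
  qed
  have "\<bar>compound_geometric_tail lam c F D u - compound_geometric_tail lam' c F' D' u\<bar>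
      = \<bar>(\<Sum>n. (1 - p) * (p ^ n * (1 - df_conv_power A n u)))
          - (\<Sum>n. (1 - q) * (q ^ n * (1 - df_conv_power A' n u)))\<bar>"
    using compound_geometric_tail_eq[of c F D lam p u] compound_geometric_tail_eq[of c F' D' lam' q u]
      A p q u assms(10,11) by (simp add: A_def A'_def p_def q_def)
  also have "\<dots> \<le> (p * e + \<bar>p - q\<bar>) / (1 - p)"
  proof (rule suminf_geometric_weights_perturb_le)
    fix n
    show "\<bar>(1 - df_conv_power A n u) - (1 - df_conv_power A' n u)\<bar> \<le> real n * e"
      using df_conv_power_diff_le[OF A AA', of n u] by linarith
    show "1 - df_conv_power A' n u \<le> 1 - df_conv_power A' (Suc n) u"
      using df_conv_power_Suc_le[OF A(2)] by simp
  qed (use p q u in \<open>auto simp: nonneg_df_nonneg nonneg_df_le_one nonneg_df_df_conv_power A\<close>)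
  \<comment> \<open>Expanding the fraction by \<open>c\<close> turns \<open>p\<close> and
    \<open>q\<close> back into \<open>lam * \<mu>\<close> and \<open>lam' * \<mu>'\<close>.\<close>
  also have "\<dots> = 1 / (c - lam * \<mu>) * (lam * \<mu> * e + \<bar>lam * \<mu> - lam' * \<mu>'\<bar>)"
  proof -
    have "c * p = lam * \<mu>" "c * q = lam' * \<mu>'"
      using assms(1) by (auto simp: p_def q_def)
    moreover have "(p * e + \<bar>p - q\<bar>) / (1 - p) = (c * p * e + c * \<bar>p - q\<bar>) / (c - c * p)"
      using mult_divide_mult_cancel_left[of c "p * e + \<bar>p - q\<bar>" "1 - p"] assms(1)
      by (simp add: algebra_simps)
    moreover have "c * \<bar>p - q\<bar> = \<bar>c * p - c * q\<bar>"
      using assms(1) by (simp add: abs_mult flip: right_diff_distrib)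
    ultimately show ?thesis by simp
  qed
  \<comment> \<open>The net profit condition makes the prefactor positive, so the nonnegative
    Kantorovich term of the diffusion parts can be added.\<close>
  also have "\<dots> \<le> 1 / (c - lam * \<mu>) *
        (lam * \<mu> * (c / D * kantorovich (diffusion_df c D) (diffusion_df c D') + e)
         + \<bar>lam * \<mu> - lam' * \<mu>'\<bar>)"
    using assms \<mu> by (intro mult_left_mono add_right_mono) (auto simp: kantorovich_nonneg divide_simps)
  finally show "ereal \<bar>compound_geometric_tail lam c F D u - compound_geometric_tail lam' c F' D' u\<bar>
    \<le> ereal (1 / (c - lam * \<mu>) *
        (lam * \<mu> * (c / D * kantorovich (diffusion_df c D) (diffusion_df c D')
                   + \<bar>D' - D\<bar> / D + kantorovich F F' / \<mu> + \<bar>\<mu>' - \<mu>\<bar> / \<mu>)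
         + \<bar>lam * \<mu> - lam' * \<mu>'\<bar>))"
    by (simp add: e_def add.assoc)
qed

end
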